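(* Let $d \geq 2$, let $\mathcal{X}, \mathcal{Y} \subset \mathbb{R}^d$ be Borel sets, let $\mu$ be a probability measure on $\mathcal{X}$ that is absolutely continuous with respect to $d$-dimensional Lebesgue measure and satisfies $\int_{\mathcal{X}} \|x\| \, \mu(dx) < \infty$, and let $\nu = \sum_{j=1}^n \nu_j \delta_{y_j}$ be a probability measure on $\mathcal{Y}$, where $n \in \mathbb{N}$, $y_1,\ldots,y_n \in \mathcal{Y}$ are pairwise distinct and $\nu_1,\ldots,\nu_n \in (0,1]$. Then there is a $\mu$-a.e. unique solution $T_*$ to Monge's problem with Euclidean cost, i.e. there is a transport map $T_*$ from $\mu$ to $\nu$ attaining $$\inf_{T} \int_{\mathcal{X}} \|x - T(x)\| \, \mu(dx),$$ where the infimum is over all transport maps $T$ from $\mu$ to $\nu$, and any two transport maps attaining this infimum agree $\mu$-almost everywhere. Moreover, the coupling $\pi_{T_*}$ induced by $T_*$ is the unique solution to the Monge--Kantorovich problem, i.e. it is the unique transport plan $\pi$ between $\mu$ and $\nu$ attaining $$W_1(\mu,\nu) = \min_{\pi} \int_{\mathcal{X} \times \mathcal{Y}} \|x-y\| \, \pi(dx,dy),$$ where the minimum is over all transport plans between $\mu$ and $\nu$; consequently $$W_1(\mu,\nu) = \int_{\mathcal{X}} \|x - T_*(x)\| \, \mu(dx).$$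
   Context: $\|\cdot\|$ is the Euclidean norm on $\mathbb{R}^d$ and $\delta_y$ is the Dirac measure at $y$. A transport map from $\mu$ to $\nu$ is a measurable map $T \colon \mathcal{X} \to \mathcal{Y}$ with $T_{\#}\mu = \nu$, i.e. $\mu(T^{-1}(A)) = \nu(A)$ for every Borel set $A \subset \mathcal{Y}$. A transport plan (coupling) between $\mu$ and $\nu$ is a measure $\pi$ on $\mathcal{X} \times \mathcal{Y}$ with marginals $\pi(A \times \mathcal{Y}) = \mu(A)$ and $\pi(\mathcal{X} \times B) = \nu(B)$ for all Borel sets $A \subset \mathcal{X}$, $B \subset \mathcal{Y}$. The coupling induced by a transport map $T$ is the measure $\pi_T$ given by $\pi_T(A \times B) = \mu(A \cap T^{-1}(B))$ for all Borel sets $A \subset \mathcal{X}$, $B \subset \mathcal{Y}$. $W_1(\mu,\nu)$ denotes the Wasserstein distance of order $1$, defined by the minimum in the claim. *)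

theory Defs
  imports "HOL-Probability.Probability"
begin

definition transport_map :: "'a measure \<Rightarrow> 'b measure \<Rightarrow> ('a \<Rightarrow> 'b) \<Rightarrow> bool" where
  "transport_map \<mu> \<nu> T \<longleftrightarrow> T \<in> measurable \<mu> \<nu> \<and> distr \<mu> \<nu> T = \<nu>"

definition transport_plan :: "'a measure \<Rightarrow> 'b measure \<Rightarrow> ('a \<times> 'b) measure \<Rightarrow> bool" where
  "transport_plan \<mu> \<nu> \<pi> \<longleftrightarrow>
     sets \<pi> = sets (\<mu> \<Otimes>\<^sub>M \<nu>) \<and>
     (\<forall>A\<in>sets \<mu>. emeasure \<pi> (A \<times> space \<nu>) = emeasure \<mu> A) \<and>
     (\<forall>B\<in>sets \<nu>. emeasure \<pi> (space \<mu> \<times> B) = emeasure \<nu> B)"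

text \<open>For a transport map \<open>T\<close> this is the unique measure with value
  \<open>\<mu> (A \<inter> T -` B)\<close> on rectangles \<open>A \<times> B\<close>; see \<open>eq_induced_coupling_iff\<close> below.\<close>

definition induced_coupling ::
    "'a measure \<Rightarrow> 'b measure \<Rightarrow> ('a \<Rightarrow> 'b) \<Rightarrow> ('a \<times> 'b) measure" where
  "induced_coupling \<mu> \<nu> T = distr \<mu> (\<mu> \<Otimes>\<^sub>M \<nu>) (\<lambda>x. (x, T x))"

text \<open>Costs are nonnegative integrals in \<^typ>\<open>ennreal\<close>, so that a map or plan whose cost
  diverges has cost \<open>\<infinity>\<close> and not the default value \<open>0\<close> of the Bochner integral.\<close>

definition monge_cost ::
    "'a::real_normed_vector measure \<Rightarrow> ('a \<Rightarrow> 'a) \<Rightarrow> ennreal" where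
  "monge_cost \<mu> T = (\<integral>\<^sup>+ x. ennreal (norm (x - T x)) \<partial>\<mu>)"

definition kantorovich_cost ::
    "('a::real_normed_vector \<times> 'a) measure \<Rightarrow> ennreal" where
  "kantorovich_cost \<pi> = (\<integral>\<^sup>+ (x, y). ennreal (norm (x - y)) \<partial>\<pi>)"

definition monge_solution ::
    "'a::real_normed_vector measure \<Rightarrow> 'a measure \<Rightarrow> ('a \<Rightarrow> 'a) \<Rightarrow> bool" where
  "monge_solution \<mu> \<nu> T \<longleftrightarrow>
     transport_map \<mu> \<nu> T \<and>
     monge_cost \<mu> T = (INF S \<in> {S. transport_map \<mu> \<nu> S}. monge_cost \<mu> S)"

definition W1 ::
    "'a::real_normed_vector measure \<Rightarrow> 'a measure \<Rightarrow> ennreal" where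
  "W1 \<mu> \<nu> = (INF \<pi> \<in> {\<pi>. transport_plan \<mu> \<nu> \<pi>}. kantorovich_cost \<pi>)"

definition kantorovich_solution ::
    "'a::real_normed_vector measure \<Rightarrow> 'a measure \<Rightarrow> ('a \<times> 'a) measure \<Rightarrow> bool" where
  "kantorovich_solution \<mu> \<nu> \<pi> \<longleftrightarrow>
     transport_plan \<mu> \<nu> \<pi> \<and> kantorovich_cost \<pi> = W1 \<mu> \<nu>"

lemma transport_map_iff:
  "transport_map \<mu> \<nu> T \<longleftrightarrow>
     T \<in> measurable \<mu> \<nu> \<and> (\<forall>A\<in>sets \<nu>. emeasure \<mu> (T -` A \<inter> space \<mu>) = emeasure \<nu> A)"
  unfolding transport_map_def
proof (intro conj_cong refl iffI ballI)
  fix A assume "T \<in> measurable \<mu> \<nu>" "distr \<mu> \<nu> T = \<nu>" "A \<in> sets \<nu>"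
  then show "emeasure \<mu> (T -` A \<inter> space \<mu>) = emeasure \<nu> A"
    by (metis emeasure_distr)
next
  assume "T \<in> measurable \<mu> \<nu>" "\<forall>A\<in>sets \<nu>. emeasure \<mu> (T -` A \<inter> space \<mu>) = emeasure \<nu> A"
  then show "distr \<mu> \<nu> T = \<nu>"
    by (intro measure_eqI) (auto simp: emeasure_distr)
qed

lemma emeasure_induced_coupling:
  assumes T: "T \<in> measurable \<mu> \<nu>" and A: "A \<in> sets \<mu>" and B: "B \<in> sets \<nu>"
  shows "emeasure (induced_coupling \<mu> \<nu> T) (A \<times> B) = emeasure \<mu> (A \<inter> T -` B)"
proof -
  have m: "(\<lambda>x. (x, T x)) \<in> measurable \<mu> (\<mu> \<Otimes>\<^sub>M \<nu>)"
    using T by simp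
  have "(\<lambda>x. (x, T x)) -` (A \<times> B) \<inter> space \<mu> = A \<inter> T -` B"
    using sets.sets_into_space[OF A] by auto
  then show ?thesis
    unfolding induced_coupling_def using A B by (simp add: emeasure_distr[OF m])
qed

lemma eq_induced_coupling_iff:
  assumes "finite_measure \<mu>" and T: "T \<in> measurable \<mu> \<nu>"
  shows "\<pi> = induced_coupling \<mu> \<nu> T \<longleftrightarrow>
    sets \<pi> = sets (\<mu> \<Otimes>\<^sub>M \<nu>) \<and>
    (\<forall>A\<in>sets \<mu>. \<forall>B\<in>sets \<nu>. emeasure \<pi> (A \<times> B) = emeasure \<mu> (A \<inter> T -` B))"
proof
  assume "\<pi> = induced_coupling \<mu> \<nu> T"
  then show "sets \<pi> = sets (\<mu> \<Otimes>\<^sub>M \<nu>) \<and>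
    (\<forall>A\<in>sets \<mu>. \<forall>B\<in>sets \<nu>. emeasure \<pi> (A \<times> B) = emeasure \<mu> (A \<inter> T -` B))"
    using emeasure_induced_coupling[OF T] by (auto simp: induced_coupling_def)
next
  interpret finite_measure \<mu> by fact
  assume *: "sets \<pi> = sets (\<mu> \<Otimes>\<^sub>M \<nu>) \<and>
    (\<forall>A\<in>sets \<mu>. \<forall>B\<in>sets \<nu>. emeasure \<pi> (A \<times> B) = emeasure \<mu> (A \<inter> T -` B))"
  show "\<pi> = induced_coupling \<mu> \<nu> T"
  proof (rule measure_eqI_generator_eq[OF Int_stable_pair_measure_generator[of \<mu> \<nu>],
        where A = "\<lambda>_. space \<mu> \<times> space \<nu>"])
    show "{a \<times> b |a b. a \<in> sets \<mu> \<and> b \<in> sets \<nu>} \<subseteq> Pow (space \<mu> \<times> space \<nu>)"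
      by (rule pair_measure_closed)
    show "sets \<pi> = sigma_sets (space \<mu> \<times> space \<nu>) {a \<times> b |a b. a \<in> sets \<mu> \<and> b \<in> sets \<nu>}"
      using * by (simp add: sets_pair_measure)
    show "sets (induced_coupling \<mu> \<nu> T) =
        sigma_sets (space \<mu> \<times> space \<nu>) {a \<times> b |a b. a \<in> sets \<mu> \<and> b \<in> sets \<nu>}"
      by (simp add: induced_coupling_def sets_pair_measure)
    show "emeasure \<pi> X = emeasure (induced_coupling \<mu> \<nu> T) X"
      if "X \<in> {a \<times> b |a b. a \<in> sets \<mu> \<and> b \<in> sets \<nu>}" for X
      using that * emeasure_induced_coupling[OF T] by auto
    show "emeasure \<pi> (space \<mu> \<times> space \<nu>) \<noteq> \<infinity>"
      using * by (simp add: emeasure_finite)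
  qed auto
qed

end

theory Submission
  imports Defs
begin

text \<open>
  For a maximizer \<open>\<phi>\<close> of the concave dual functional
  \<open>\<Sum>\<^sub>j w\<^sub>j \<phi>\<^sub>j + \<integral> min\<^sub>j (\<parallel>x - y\<^sub>j\<parallel> - \<phi>\<^sub>j) \<mu>(dx)\<close>, the cell of points \<open>x\<close> at which the minimum is
  attained at \<open>j\<close> has mass \<open>w\<^sub>j\<close>. Two cells overlap only in a set where \<open>\<parallel>x - y\<^sub>j\<parallel> - \<parallel>x - y\<^sub>k\<parallel>\<close> is
  constant, a hyperplane, a sheet of a hyperboloid or a ray, which is Lebesgue null as \<open>d \<ge> 2\<close>. Hence
  sending the \<open>j\<close>-th cell to \<open>y\<^sub>j\<close> is a transport map. The dual functional bounds the cost
  of every plan from below, with equality only for plans concentrated on pairs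
  \<open>(x, y\<^sub>j)\<close> with \<open>x\<close> in the \<open>j\<close>-th cell, which are almost surely of the form \<open>(x, T x)\<close>.
\<close>

section \<open>Level sets of a difference of two distances\<close>

text \<open>Squaring \<open>norm (u + v) = c + norm u\<close> with \<open>u = x - b\<close> and
  \<open>v = b - a\<close> cancels the quadratic term in \<open>u\<close>; what remains is
  positively homogeneous of degree one in \<open>u\<close> apart from the constant \<open>K\<close>.
  In dimension one the result fails: for \<open>c = norm v\<close> the set is a half-line.\<close>

lemma negligible_dist_difference:
  fixes a b :: "'a::euclidean_space"
  assumes dim: "DIM('a) \<ge> 2" and ab: "a \<noteq> b"
  shows "negligible {x. norm (x - a) - norm (x - b) = c}"
proof -
  define v where "v = b - a"
  define K where "K = v \<bullet> v - c\<^sup>2"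
  have v: "v \<noteq> 0" using ab by (simp add: v_def)
  have ray: "2 * c * norm u = 2 * (u \<bullet> v) + K"
    if "norm (b + u - a) - norm (b + u - b) = c" for u
  proof -
    have "norm (u + v) = c + norm u"
      using that by (simp add: v_def algebra_simps)
    then have "(norm (u + v))\<^sup>2 = (c + norm u)\<^sup>2" by simp
    then show ?thesis
      unfolding K_def power2_norm_eq_inner power2_sum
      by (simp add: inner_simps inner_commute)
  qed
  have closed: "closed {x. norm (x - a) - norm (x - b) = c}"
    by (intro closed_Collect_eq continuous_intros)
  \<comment> \<open>On each ray from \<open>b\<close> the equation \<open>ray\<close> is affine in the radius with constant term \<open>K\<close>,
    so that a ray meets the set at most once unless \<open>K = 0\<close>, where the set lies on a line.\<close>
  show ?thesis
  proof (cases "K = 0")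
    case False
    show ?thesis
    proof (rule starlike_negligible[OF closed, of b])
      fix t :: real and u :: 'a
      assume "b + t *\<^sub>R u \<in> {x. norm (x - a) - norm (x - b) = c}" "0 \<le> t"
        and "b + u \<in> {x. norm (x - a) - norm (x - b) = c}"
      then have 1: "2 * c * norm (t *\<^sub>R u) = 2 * (t *\<^sub>R u \<bullet> v) + K"
        and 2: "2 * c * norm u = 2 * (u \<bullet> v) + K"
        using ray by blast+
      from 1 have "t * (2 * c * norm u) = t * (2 * (u \<bullet> v)) + K"
        using \<open>0 \<le> t\<close> by (simp add: algebra_simps)
      then have "(t - 1) * K = 0"
        unfolding 2 by (simp add: algebra_simps)
      with False show "t = 1" by simp
    qed
  next
    case True
    \<comment> \<open>Dimension at least two enters here. The hyperplane through \<open>b\<close>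
      with normal \<open>z\<close> contains the line through \<open>a\<close> and
      \<open>b\<close>.\<close>
    obtain z :: 'a where z: "z \<noteq> 0" "orthogonal v z"
      using orthogonal_to_vector_exists[OF dim] by blast
    have c: "\<bar>c\<bar> = norm v"
      using True by (simp add: K_def norm_eq_sqrt_inner real_sqrt_abs[symmetric] del: real_sqrt_abs)
    have "z \<bullet> x = z \<bullet> b" if "norm (x - a) - norm (x - b) = c" for x
    proof -
      have "c * norm (x - b) = (x - b) \<bullet> v"
        using ray[of "x - b"] that True by simp
      \<comment> \<open>As \<open>\<bar>c\<bar> = norm v\<close>, this is the equality case of
        Cauchy-Schwarz, which makes \<open>x - b\<close> parallel to \<open>v\<close>.\<close>
      then have "\<bar>v \<bullet> (x - b)\<bar> = norm v * norm (x - b)"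
        by (metis c abs_mult abs_norm_cancel inner_commute)
      then have "norm v *\<^sub>R (x - b) = norm (x - b) *\<^sub>R v \<or>
          norm v *\<^sub>R (x - b) = - norm (x - b) *\<^sub>R v"
        by (simp add: norm_cauchy_schwarz_abs_eq)
      then have "z \<bullet> (norm v *\<^sub>R (x - b)) = 0"
      proof (elim disjE)
        assume eq: "norm v *\<^sub>R (x - b) = norm (x - b) *\<^sub>R v"
        show ?thesis unfolding eq using z(2) by (simp add: orthogonal_def inner_commute)
      next
        assume eq: "norm v *\<^sub>R (x - b) = - norm (x - b) *\<^sub>R v"
        show ?thesis unfolding eq using z(2) by (simp add: orthogonal_def inner_commute)
      qed
      then show ?thesis using v by (simp add: inner_diff_right)
    qed
    then show ?thesis
      using z(1) by (intro negligible_subset[OF negligible_hyperplane[of z "z \<bullet> b"]]) auto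
  qed
qed

section \<open>c-transforms of potentials on a finite set\<close>

text \<open>For distances \<open>c j x\<close>, the sets where a given index attains this minimum
  are additively weighted Voronoi cells. \<open>Min\<close> is unspecified on the empty set, hence
  the assumption \<open>J \<noteq> {}\<close> below.\<close>

definition c_transform :: "'i set \<Rightarrow> ('i \<Rightarrow> 'a \<Rightarrow> real) \<Rightarrow> ('i \<Rightarrow> real) \<Rightarrow> 'a \<Rightarrow> real" where
  "c_transform J c \<phi> x = Min ((\<lambda>j. c j x - \<phi> j) ` J)"

lemma c_transform_le: "finite J \<Longrightarrow> j \<in> J \<Longrightarrow> c_transform J c \<phi> x \<le> c j x - \<phi> j"
  unfolding c_transform_def by (intro Min_le) auto

lemma c_transform_attained:
  assumes "finite J" "J \<noteq> {}"
  obtains j where "j \<in> J" "c_transform J c \<phi> x = c j x - \<phi> j"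
proof -
  have "Min ((\<lambda>j. c j x - \<phi> j) ` J) \<in> (\<lambda>j. c j x - \<phi> j) ` J"
    using assms by (intro Min_in) auto
  then show ?thesis using that unfolding c_transform_def by blast
qed

text \<open>An index attaining the minimum for \<open>\<psi>\<close> is a competitor in the minimum
  for \<open>\<phi>\<close>. The bound is uniform in \<open>x\<close>, so it passes through the
  integral and yields continuity of the dual functional.\<close>

lemma c_transform_lipschitz:
  assumes J: "finite J" "J \<noteq> {}"
  shows "\<bar>c_transform J c \<phi> x - c_transform J c \<psi> x\<bar> \<le> (\<Sum>j\<in>J. \<bar>\<phi> j - \<psi> j\<bar>)"
proof -
  have *: "c_transform J c \<phi> x - c_transform J c \<psi> x \<le> (\<Sum>j\<in>J. \<bar>\<phi> j - \<psi> j\<bar>)" for \<phi> \<psi>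
  proof -
    obtain j where j: "j \<in> J" "c_transform J c \<psi> x = c j x - \<psi> j"
      using c_transform_attained[OF J] .
    have "\<bar>\<phi> j - \<psi> j\<bar> \<le> (\<Sum>j\<in>J. \<bar>\<phi> j - \<psi> j\<bar>)"
      using J(1) j(1) by (intro member_le_sum) auto
    then show ?thesis using c_transform_le[OF J(1) j(1), of c \<phi> x] j(2) by linarith
  qed
  show ?thesis using *[of \<phi> \<psi>] *[of \<psi> \<phi>] by (simp add: abs_minus_commute abs_le_iff)
qed

lemma integrable_c_transform:
  assumes J: "finite J" "J \<noteq> {}" and M: "finite_measure M"
    and c: "\<And>j. j \<in> J \<Longrightarrow> integrable M (c j)"
  shows "integrable M (c_transform J c \<phi>)"
proof -
  interpret finite_measure M by fact
  show ?thesis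
  proof (rule Bochner_Integration.integrable_bound)
    show "integrable M (\<lambda>x. \<Sum>j\<in>J. \<bar>c j x - \<phi> j\<bar>)"
      using c by (intro Bochner_Integration.integrable_sum integrable_abs
        Bochner_Integration.integrable_diff) auto
    show "c_transform J c \<phi> \<in> borel_measurable M"
      unfolding c_transform_def[abs_def]
      using J c by (intro borel_measurable_Min borel_measurable_diff) auto
    have "\<bar>c_transform J c \<phi> x\<bar> \<le> (\<Sum>j\<in>J. \<bar>c j x - \<phi> j\<bar>)" for x
    proof -
      obtain j where "j \<in> J" "c_transform J c \<phi> x = c j x - \<phi> j"
        using c_transform_attained[OF J] .
      then show ?thesis
        using J(1) by (auto intro!: member_le_sum[of j J "\<lambda>j. \<bar>c j x - \<phi> j\<bar>"])
    qed
    then show "AE x in M. norm (c_transform J c \<phi> x) \<le> norm (\<Sum>j\<in>J. \<bar>c j x - \<phi> j\<bar>)"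
      by (intro always_eventually allI) (simp add: sum_nonneg)
  qed
qed

section \<open>Dual maximizers and the masses of their cells\<close>

text \<open>Tychonoff's theorem. Potentials are functions on the whole index type, so the product
  runs over all of it and not only over the finite \<open>J\<close>.\<close>

lemma compact_Pi_UNIV:
  fixes S :: "'i \<Rightarrow> 'b::topological_space set"
  assumes "\<And>i. compact (S i)"
  shows "compact (Pi UNIV S)"
proof -
  have "compactin (product_topology (\<lambda>i. euclidean) UNIV) (PiE UNIV S)"
    using assms by (auto simp: compactin_PiE)
  then show ?thesis
    by (simp add: euclidean_product_topology PiE_UNIV_domain)
qed

text \<open>A potential whose values differ by more than the oscillation \<open>R\<close> of the costs can be
  truncated without decreasing the dual functional, so that the compact box \<open>[0, R]\<^sup>J\<close> contains
  a maximizer.\<close>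

lemma dual_maximizer_exists:
  fixes c :: "'i \<Rightarrow> 'a \<Rightarrow> real"
  assumes M: "prob_space M" and J: "finite J" "J \<noteq> {}"
    and c: "\<And>j. j \<in> J \<Longrightarrow> integrable M (c j)"
    and R: "\<And>j k x. j \<in> J \<Longrightarrow> k \<in> J \<Longrightarrow> x \<in> space M \<Longrightarrow> c j x - c k x \<le> R"
    and w: "\<And>j. j \<in> J \<Longrightarrow> 0 \<le> w j" "sum w J = 1"
  obtains \<phi> where "\<And>\<psi>. (\<Sum>j\<in>J. w j * \<psi> j) + (\<integral>x. c_transform J c \<psi> x \<partial>M)
      \<le> (\<Sum>j\<in>J. w j * \<phi> j) + (\<integral>x. c_transform J c \<phi> x \<partial>M)"
proof -
  interpret prob_space M by fact
  define g where "g \<psi> = (\<Sum>j\<in>J. w j * \<psi> j) + (\<integral>x. c_transform J c \<psi> x \<partial>M)" for \<psi>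
  have int: "integrable M (c_transform J c \<psi>)" for \<psi>
    using J finite_measure_axioms c by (rule integrable_c_transform)
  have g_lip: "\<bar>g \<psi> - g \<xi>\<bar> \<le> (\<Sum>j\<in>J. w j * \<bar>\<psi> j - \<xi> j\<bar>) + (\<Sum>j\<in>J. \<bar>\<psi> j - \<xi> j\<bar>)" for \<psi> \<xi>
  proof -
    have "\<bar>(\<integral>x. c_transform J c \<psi> x \<partial>M) - (\<integral>x. c_transform J c \<xi> x \<partial>M)\<bar>
        = \<bar>\<integral>x. c_transform J c \<psi> x - c_transform J c \<xi> x \<partial>M\<bar>"
      using int by simp
    also have "\<dots> \<le> (\<integral>x. \<bar>c_transform J c \<psi> x - c_transform J c \<xi> x\<bar> \<partial>M)"
      by (rule integral_abs_bound)
    also have "\<dots> \<le> (\<integral>x. (\<Sum>j\<in>J. \<bar>\<psi> j - \<xi> j\<bar>) \<partial>M)"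
      using int by (intro integral_mono c_transform_lipschitz[OF J]) auto
    finally have "\<bar>(\<integral>x. c_transform J c \<psi> x \<partial>M) - (\<integral>x. c_transform J c \<xi> x \<partial>M)\<bar>
        \<le> (\<Sum>j\<in>J. \<bar>\<psi> j - \<xi> j\<bar>)" by (simp add: prob_space)
    moreover have "\<bar>(\<Sum>j\<in>J. w j * \<psi> j) - (\<Sum>j\<in>J. w j * \<xi> j)\<bar> \<le> (\<Sum>j\<in>J. w j * \<bar>\<psi> j - \<xi> j\<bar>)"
    proof -
      have "\<bar>\<Sum>j\<in>J. w j * (\<psi> j - \<xi> j)\<bar> \<le> (\<Sum>j\<in>J. \<bar>w j * (\<psi> j - \<xi> j)\<bar>)"
        by (rule sum_abs)
      also have "\<dots> = (\<Sum>j\<in>J. w j * \<bar>\<psi> j - \<xi> j\<bar>)"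
        using w(1) by (intro sum.cong) (auto simp: abs_mult)
      finally show ?thesis by (simp add: right_diff_distrib sum_subtractf)
    qed
    ultimately show ?thesis unfolding g_def by linarith
  qed
  \<comment> \<open>The topology is the product topology; the bound \<open>g_lip\<close> involves
    only the finitely many coordinates in \<open>J\<close>, each of them continuous.\<close>
  have "continuous_on UNIV g"
    unfolding continuous_on_def
  proof
    fix \<psi> :: "'i \<Rightarrow> real"
    have coord: "((\<lambda>\<xi>. \<xi> j) \<longlongrightarrow> \<psi> j) (at \<psi>)" for j
    proof -
      have "continuous_on UNIV (\<lambda>\<xi> :: 'i \<Rightarrow> real. \<xi> j)" by simp
      then show ?thesis unfolding continuous_on_def by blast
    qed
    have "((\<lambda>\<xi>. (\<Sum>j\<in>J. w j * \<bar>\<xi> j - \<psi> j\<bar>) + (\<Sum>j\<in>J. \<bar>\<xi> j - \<psi> j\<bar>)) \<longlongrightarrow>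
        (\<Sum>j\<in>J. w j * \<bar>\<psi> j - \<psi> j\<bar>) + (\<Sum>j\<in>J. \<bar>\<psi> j - \<psi> j\<bar>)) (at \<psi>)"
      by (intro tendsto_intros coord)
    then have "((\<lambda>\<xi>. (\<Sum>j\<in>J. w j * \<bar>\<xi> j - \<psi> j\<bar>) + (\<Sum>j\<in>J. \<bar>\<xi> j - \<psi> j\<bar>)) \<longlongrightarrow> 0) (at \<psi>)"
      by simp
    then have "((\<lambda>\<xi>. g \<xi> - g \<psi>) \<longlongrightarrow> 0) (at \<psi>)"
      by (rule Lim_null_comparison[rotated]) (simp add: g_lip)
    then show "(g \<longlongrightarrow> g \<psi>) (at \<psi> within UNIV)"
      by (simp add: LIM_zero_iff)
  qed
  moreover have "compact (Pi UNIV (\<lambda>_. {0..R}) :: ('i \<Rightarrow> real) set)"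
    by (intro compact_Pi_UNIV) auto
  moreover have R0: "0 \<le> R"
  proof -
    obtain x j where "x \<in> space M" "j \<in> J" using not_empty J(2) by blast
    then show ?thesis using R[of j j x] by simp
  qed
  moreover have "(\<lambda>_. 0) \<in> (Pi UNIV (\<lambda>_. {0..R}) :: ('i \<Rightarrow> real) set)"
    using R0 by auto
  ultimately have "\<exists>\<phi>\<in>Pi UNIV (\<lambda>_. {0..R}). \<forall>\<psi>\<in>Pi UNIV (\<lambda>_. {0..R}). g \<psi> \<le> g \<phi>"
    by (intro continuous_attains_sup) (auto intro: continuous_on_subset)
  then obtain \<phi> where \<phi>: "\<And>\<psi>. \<psi> \<in> Pi UNIV (\<lambda>_. {0..R}) \<Longrightarrow> g \<psi> \<le> g \<phi>"
    by blast
  have "g \<psi> \<le> g \<phi>" for \<psi>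
  proof -
    \<comment> \<open>Adding \<open>R - s\<close> to every coordinate does not change the
      functional, since both \<open>w\<close> and \<open>M\<close> have total mass one.
      \<open>\<psi>'\<close> makes this shift, which puts the maximum at \<open>R\<close>, and cuts
      off negative values; the value 0 off \<open>J\<close> keeps it in the box.\<close>
    define s where "s = Max (\<psi> ` J)"
    define \<psi>' where "\<psi>' j = (if j \<in> J then max (\<psi> j - s + R) 0 else 0)" for j
    have s: "\<psi> j \<le> s" if "j \<in> J" for j using that J by (simp add: s_def)
    have "s \<in> \<psi> ` J" unfolding s_def using J by (intro Max_in) auto
    then obtain k where k: "k \<in> J" "\<psi> k = s" by blast
    have "\<psi>' \<in> Pi UNIV (\<lambda>_. {0..R})"
      using s R0 by (auto simp: \<psi>'_def)
    then have "g \<psi>' \<le> g \<phi>" by (rule \<phi>)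
    moreover have "g \<psi> \<le> g \<psi>'"
    proof -
      have "(\<Sum>j\<in>J. w j * \<psi> j) + (R - s) = (\<Sum>j\<in>J. w j * \<psi> j) + sum w J * (R - s)"
        using w(2) by simp
      also have "\<dots> = (\<Sum>j\<in>J. w j * (\<psi> j - s + R))"
        unfolding sum_distrib_right sum.distrib[symmetric]
        by (intro sum.cong) (auto simp: algebra_simps)
      also have "\<dots> \<le> (\<Sum>j\<in>J. w j * \<psi>' j)"
        using w(1) by (intro sum_mono mult_left_mono) (auto simp: \<psi>'_def)
      finally have 1: "(\<Sum>j\<in>J. w j * \<psi> j) + (R - s) \<le> (\<Sum>j\<in>J. w j * \<psi>' j)" .
      \<comment> \<open>Where the minimum sits at a truncated index \<open>j\<close>, the index
        \<open>k\<close> of the largest potential competes: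
        \<open>c k x - R \<le> c j x\<close>.\<close>
      have "c_transform J c \<psi> x + (s - R) \<le> c_transform J c \<psi>' x" if x: "x \<in> space M" for x
      proof -
        obtain j where j: "j \<in> J" "c_transform J c \<psi>' x = c j x - \<psi>' j"
          using c_transform_attained[OF J] .
        show ?thesis
          using c_transform_le[OF J(1) j(1), of c \<psi> x] c_transform_le[OF J(1) k(1), of c \<psi> x]
            R[OF k(1) j(1) x] k(2) j by (auto simp: \<psi>'_def max_def)
      qed
      then have "(\<integral>x. c_transform J c \<psi> x + (s - R) \<partial>M) \<le> (\<integral>x. c_transform J c \<psi>' x \<partial>M)"
        using int by (intro integral_mono) auto
      then have "(\<integral>x. c_transform J c \<psi> x \<partial>M) + (s - R) \<le> (\<integral>x. c_transform J c \<psi>' x \<partial>M)"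
        using int by (simp add: prob_space)
      with 1 show ?thesis unfolding g_def by linarith
    qed
    ultimately show ?thesis by linarith
  qed
  then show ?thesis using that unfolding g_def by blast
qed

text \<open>Raising one coordinate of a maximizer by \<open>t\<close> cannot increase the dual functional; as
  \<open>t \<rightarrow> 0\<close> this bounds the mass of each cell from below by its weight. No mass is shared by two
  cells, so that the bounds, which sum to \<open>1\<close>, are attained.\<close>

lemma optimal_cell_weights:
  fixes c :: "'i \<Rightarrow> 'a \<Rightarrow> real"
  assumes M: "prob_space M" and J: "finite J" "J \<noteq> {}"
    and c: "\<And>j. j \<in> J \<Longrightarrow> integrable M (c j)"
    and R: "\<And>j k x. j \<in> J \<Longrightarrow> k \<in> J \<Longrightarrow> x \<in> space M \<Longrightarrow> c j x - c k x \<le> R"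
    and ties: "\<And>j k t. j \<in> J \<Longrightarrow> k \<in> J \<Longrightarrow> j \<noteq> k \<Longrightarrow> AE x in M. c j x - c k x \<noteq> t"
    and w: "\<And>j. j \<in> J \<Longrightarrow> 0 \<le> w j" "sum w J = 1"
  obtains \<phi> where "\<And>j. j \<in> J \<Longrightarrow>
    measure M {x \<in> space M. c j x - \<phi> j = c_transform J c \<phi> x} = w j"
proof -
  interpret prob_space M by fact
  obtain \<phi> where max: "\<And>\<psi>. (\<Sum>j\<in>J. w j * \<psi> j) + (\<integral>x. c_transform J c \<psi> x \<partial>M)
      \<le> (\<Sum>j\<in>J. w j * \<phi> j) + (\<integral>x. c_transform J c \<phi> x \<partial>M)"
    by (rule dual_maximizer_exists[OF M J, of c R w]) (use c R w in auto)
  have int: "integrable M (c_transform J c \<psi>)" for \<psi>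
    using J finite_measure_axioms c by (rule integrable_c_transform)
  have [measurable]: "c_transform J c \<psi> \<in> borel_measurable M" for \<psi>
    using int by auto
  define L where "L j = {x \<in> space M. c j x - \<phi> j = c_transform J c \<phi> x}" for j
  have Lm: "L j \<in> sets M" if "j \<in> J" for j
  proof -
    have [measurable]: "c j \<in> borel_measurable M" using c[OF that] by auto
    show ?thesis unfolding L_def by measurable
  qed
  have ge: "w j \<le> prob (L j)" if j: "j \<in> J" for j
  proof -
    have cj [measurable]: "c j \<in> borel_measurable M" using c[OF j] by auto
    \<comment> \<open>On \<open>A t\<close> the index \<open>j\<close> is within \<open>t\<close> of
      the minimum; these sets decrease to \<open>L j\<close> as \<open>t\<close> tends to 0.\<close>
    define A where "A t = {x \<in> space M. c j x - \<phi> j - t \<le> c_transform J c \<phi> x}" for t :: real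
    have Am [measurable]: "A t \<in> sets M" for t
      unfolding A_def by measurable
    have A_mono: "A s \<subseteq> A t" if "s \<le> t" for s t
      using that by (auto simp: A_def)
    have w_le: "w j \<le> prob (A t)" if t: "t > 0" for t
    proof -
      define \<psi> where "\<psi> = \<phi>(j := \<phi> j + t)"
      have "(\<Sum>i\<in>J. w i * \<psi> i) = (\<Sum>i\<in>J. w i * \<phi> i + (if i = j then w j * t else 0))"
        by (intro sum.cong) (auto simp: \<psi>_def algebra_simps)
      then have "(\<Sum>i\<in>J. w i * \<psi> i) = (\<Sum>i\<in>J. w i * \<phi> i) + w j * t"
        using j J by (simp add: sum.distrib)
      with max[of \<psi>] have "w j * t \<le>
          (\<integral>x. c_transform J c \<phi> x \<partial>M) - (\<integral>x. c_transform J c \<psi> x \<partial>M)"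
        by simp
      also have "\<dots> = (\<integral>x. c_transform J c \<phi> x - c_transform J c \<psi> x \<partial>M)"
        using int by simp
      \<comment> \<open>Raising coordinate \<open>j\<close> lowers the minimum by at most
        \<open>t\<close>, and only on \<open>A t\<close>.\<close>
      also have "\<dots> \<le> (\<integral>x. t * indicator (A t) x \<partial>M)"
      proof (intro integral_mono)
        show "integrable M (\<lambda>x. c_transform J c \<phi> x - c_transform J c \<psi> x)"
          using int by auto
        show "integrable M (\<lambda>x. t * indicator (A t) x)"
          by (intro integrable_mult_right integrable_real_indicator) (auto simp: less_top[symmetric])
        fix x assume x: "x \<in> space M"
        obtain k where k: "k \<in> J" "c_transform J c \<psi> x = c k x - \<psi> k"
          using c_transform_attained[OF J] .
        show "c_transform J c \<phi> x - c_transform J c \<psi> x \<le> t * indicator (A t) x"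
          using c_transform_le[OF J(1) k(1), of c \<phi> x] k(2) t x
          by (auto simp: \<psi>_def A_def indicator_def split: if_splits)
      qed
      also have "\<dots> = prob (A t) * t"
        by simp
      finally show ?thesis using t by simp
    qed
    have "(\<lambda>i. prob (A (inverse (real (Suc i))))) \<longlonglongrightarrow> prob (\<Inter>i. A (inverse (real (Suc i))))"
    proof (rule finite_Lim_measure_decseq)
      show "decseq (\<lambda>i. A (inverse (real (Suc i))))"
        by (intro decseq_SucI A_mono le_imp_inverse_le) auto
    qed auto
    moreover have "(\<Inter>i. A (inverse (real (Suc i)))) = L j"
    proof (intro equalityI subsetI)
      fix x assume x: "x \<in> (\<Inter>i. A (inverse (real (Suc i))))"
      have "(\<lambda>i. c j x - \<phi> j - inverse (real (Suc i))) \<longlonglongrightarrow> c j x - \<phi> j - 0"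
        by (intro tendsto_intros LIMSEQ_inverse_real_of_nat)
      then have "c j x - \<phi> j - 0 \<le> c_transform J c \<phi> x"
        using x by (intro LIMSEQ_le_const2) (auto simp: A_def)
      then show "x \<in> L j"
        using x c_transform_le[OF J(1) j, of c \<phi> x] by (auto simp: L_def A_def)
    qed (auto simp: A_def L_def)
    ultimately show ?thesis
      using w_le by (intro LIMSEQ_le_const[of _ "prob (L j)"]) auto
  qed
  have "pairwise (\<lambda>i j. AE x in M. x \<notin> L i \<or> x \<notin> L j) J"
  proof (rule pairwiseI)
    fix i j assume "i \<in> J" "j \<in> J" "i \<noteq> j"
    \<comment> \<open>At a common point of cells \<open>i\<close> and \<open>j\<close> the costs
      differ by exactly \<open>\<phi> i - \<phi> j\<close>, a tie of probability zero.\<close>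
    from ties[OF this, of "\<phi> i - \<phi> j"] show "AE x in M. x \<notin> L i \<or> x \<notin> L j"
      by eventually_elim (auto simp: L_def)
  qed
  then have "(\<Sum>j\<in>J. prob (L j)) = prob (\<Union>j\<in>J. L j)"
    using Lm J by (intro measure_UNION_AE[symmetric]) (auto simp: fmeasurable_eq_sets)
  then have "(\<Sum>j\<in>J. prob (L j)) \<le> sum w J"
    using w(2) by simp
  moreover have "sum w J \<le> (\<Sum>j\<in>J. prob (L j))"
    using ge by (rule sum_mono)
  ultimately have "sum w J = (\<Sum>j\<in>J. prob (L j))" by simp
  then have "w j = prob (L j)" if "j \<in> J" for j
    using ge that J(1) by (rule sum_mono_inv)
  then show ?thesis using that unfolding L_def by metis
qed

section \<open>Marginals, induced couplings and Kantorovich duality\<close>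

text \<open>With the marginals as pushforwards, integrals and almost sure statements carry over from
  \<mu> and \<nu> to the plan.\<close>

lemma distr_transport_plan:
  assumes "transport_plan \<mu> \<nu> \<pi>"
  shows "distr \<pi> \<mu> fst = \<mu>" "distr \<pi> \<nu> snd = \<nu>"
proof -
  have sets [measurable_cong]: "sets \<pi> = sets (\<mu> \<Otimes>\<^sub>M \<nu>)"
    using assms by (simp add: transport_plan_def)
  have space: "space \<pi> = space \<mu> \<times> space \<nu>"
    using sets_eq_imp_space_eq[OF sets] by (simp add: space_pair_measure)
  show "distr \<pi> \<mu> fst = \<mu>"
  proof (rule measure_eqI)
    fix A assume "A \<in> sets (distr \<pi> \<mu> fst)"
    then have A: "A \<in> sets \<mu>" by simp
    have "fst -` A \<inter> space \<pi> = A \<times> space \<nu>"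
      using sets.sets_into_space[OF A] by (auto simp: space)
    then show "emeasure (distr \<pi> \<mu> fst) A = emeasure \<mu> A"
      using A assms by (simp add: emeasure_distr transport_plan_def)
  qed simp
  show "distr \<pi> \<nu> snd = \<nu>"
  proof (rule measure_eqI)
    fix A assume "A \<in> sets (distr \<pi> \<nu> snd)"
    then have A: "A \<in> sets \<nu>" by simp
    have "snd -` A \<inter> space \<pi> = space \<mu> \<times> A"
      using sets.sets_into_space[OF A] by (auto simp: space)
    then show "emeasure (distr \<pi> \<nu> snd) A = emeasure \<nu> A"
      using A assms by (simp add: emeasure_distr transport_plan_def)
  qed simp
qed

lemma transport_plan_induced_coupling:
  assumes "transport_map \<mu> \<nu> T"
  shows "transport_plan \<mu> \<nu> (induced_coupling \<mu> \<nu> T)"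
  unfolding transport_plan_def
proof (intro conjI ballI)
  have T: "T \<in> measurable \<mu> \<nu>" using assms by (simp add: transport_map_iff)
  show "sets (induced_coupling \<mu> \<nu> T) = sets (\<mu> \<Otimes>\<^sub>M \<nu>)"
    by (simp add: induced_coupling_def)
  fix A assume A: "A \<in> sets \<mu>"
  then have "A \<inter> T -` space \<nu> = A"
    using measurable_space[OF T] sets.sets_into_space[OF A] by auto
  then show "emeasure (induced_coupling \<mu> \<nu> T) (A \<times> space \<nu>) = emeasure \<mu> A"
    using emeasure_induced_coupling[OF T A sets.top] by simp
next
  fix B assume B: "B \<in> sets \<nu>"
  then show "emeasure (induced_coupling \<mu> \<nu> T) (space \<mu> \<times> B) = emeasure \<nu> B"
    using assms emeasure_induced_coupling[of T \<mu> \<nu> "space \<mu>" B]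
    by (simp add: transport_map_iff Int_commute)
qed

text \<open>Measurability of the distance is a hypothesis because the sigma-algebras of \<mu> and
  \<nu> are arbitrary here.\<close>

lemma kantorovich_cost_induced_coupling:
  assumes T: "T \<in> measurable \<mu> \<nu>"
    and m: "(\<lambda>(x, y). norm (x - y)) \<in> borel_measurable (\<mu> \<Otimes>\<^sub>M \<nu>)"
  shows "kantorovich_cost (induced_coupling \<mu> \<nu> T) = monge_cost \<mu> T"
  unfolding kantorovich_cost_def induced_coupling_def monge_cost_def
  using T m by (subst nn_integral_distr) (auto simp: split_beta')

text \<open>The identity agrees \<pi>-almost everywhere with the map sending \<open>p\<close> to
  \<open>(fst p, T (fst p))\<close>, which factors through the first marginal.\<close>

lemma transport_plan_eq_induced_coupling:
  assumes \<pi>: "transport_plan \<mu> \<nu> \<pi>" and T: "T \<in> measurable \<mu> \<nu>"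
    and eq: "AE p in \<pi>. snd p = T (fst p)"
  shows "\<pi> = induced_coupling \<mu> \<nu> T"
proof -
  have sets [measurable_cong]: "sets \<pi> = sets (\<mu> \<Otimes>\<^sub>M \<nu>)"
    using \<pi> by (simp add: transport_plan_def)
  note T [measurable]
  have "\<pi> = distr \<pi> \<pi> (\<lambda>p. p)" by simp
  also have "\<dots> = distr \<pi> (\<mu> \<Otimes>\<^sub>M \<nu>) (\<lambda>p. (fst p, T (fst p)))"
    using eq sets by (intro distr_cong_AE) (auto elim!: eventually_mono simp: prod_eq_iff)
  also have "\<dots> = distr (distr \<pi> \<mu> fst) (\<mu> \<Otimes>\<^sub>M \<nu>) (\<lambda>x. (x, T x))"
    by (subst distr_distr) (auto simp: comp_def)
  finally show ?thesis
    unfolding distr_transport_plan[OF \<pi>] induced_coupling_def .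
qed

text \<open>The conjunct \<open>0 \<le> \<dots>\<close> below is needed because \<^const>\<open>ennreal\<close> sends negative reals to \<open>0\<close>.\<close>

lemma kantorovich_cost_duality:
  fixes \<mu> \<nu> :: "'a::real_normed_vector measure"
  assumes \<pi>: "transport_plan \<mu> \<nu> \<pi>"
    and m: "(\<lambda>(x, y). norm (x - y)) \<in> borel_measurable (\<mu> \<Otimes>\<^sub>M \<nu>)"
    and f: "integrable \<mu> f" and h: "integrable \<nu> h"
    and le: "AE p in \<pi>. f (fst p) + h (snd p) \<le> norm (fst p - snd p)"
  shows "ennreal ((\<integral>x. f x \<partial>\<mu>) + (\<integral>y. h y \<partial>\<nu>)) \<le> kantorovich_cost \<pi>"
    and "0 \<le> (\<integral>x. f x \<partial>\<mu>) + (\<integral>y. h y \<partial>\<nu>) \<and>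
      kantorovich_cost \<pi> = ennreal ((\<integral>x. f x \<partial>\<mu>) + (\<integral>y. h y \<partial>\<nu>)) \<longleftrightarrow>
      (AE p in \<pi>. f (fst p) + h (snd p) = norm (fst p - snd p))"
proof -
  have sets [measurable_cong]: "sets \<pi> = sets (\<mu> \<Otimes>\<^sub>M \<nu>)"
    using \<pi> by (simp add: transport_plan_def)
  have [measurable]: "(\<lambda>p. norm (fst p - snd p)) \<in> borel_measurable \<pi>"
    using m measurable_cong_sets[OF sets refl] by (simp add: split_beta')
  have [measurable]: "f \<in> borel_measurable \<mu>" "h \<in> borel_measurable \<nu>"
    using f h by auto
  define D where "D = (\<integral>x. f x \<partial>\<mu>) + (\<integral>y. h y \<partial>\<nu>)"
  define N where "N p = norm (fst p - snd p)" for p :: "'a \<times> 'a"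
  have N [measurable]: "N \<in> borel_measurable \<pi>" unfolding N_def by measurable
  have N0: "0 \<le> N p" for p by (simp add: N_def)
  have "integrable (distr \<pi> \<mu> fst) f" "integrable (distr \<pi> \<nu> snd) h"
    using f h by (simp_all add: distr_transport_plan[OF \<pi>])
  then have fh: "integrable \<pi> (\<lambda>p. f (fst p))" "integrable \<pi> (\<lambda>p. h (snd p))"
    by (simp_all add: integrable_distr_eq)
  have "(\<integral>p. f (fst p) \<partial>\<pi>) = (\<integral>x. f x \<partial>distr \<pi> \<mu> fst)" "(\<integral>p. h (snd p) \<partial>\<pi>) = (\<integral>y. h y \<partial>distr \<pi> \<nu> snd)"
    by (simp_all add: integral_distr)
  then have D: "(\<integral>p. f (fst p) + h (snd p) \<partial>\<pi>) = D"
    using fh by (simp add: D_def distr_transport_plan[OF \<pi>])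
  have K: "kantorovich_cost \<pi> = (\<integral>\<^sup>+p. ennreal (N p) \<partial>\<pi>)"
    by (simp add: kantorovich_cost_def N_def split_beta')
  have le': "AE p in \<pi>. f (fst p) + h (snd p) \<le> N p" using le by (simp add: N_def)
  \<comment> \<open>A finite cost is the Bochner integral of \<open>N\<close>, which can be compared
    with \<open>D\<close>; at infinite cost the lower bound is trivial.\<close>
  have fin: "kantorovich_cost \<pi> = ennreal (\<integral>p. N p \<partial>\<pi>)" "integrable \<pi> N"
      "D \<le> (\<integral>p. N p \<partial>\<pi>)" if "kantorovich_cost \<pi> < \<infinity>"
  proof -
    show i: "integrable \<pi> N"
      using that by (intro integrableI_bounded) (use N N0 in \<open>auto simp: K\<close>)
    then show "kantorovich_cost \<pi> = ennreal (\<integral>p. N p \<partial>\<pi>)"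
      unfolding K by (intro nn_integral_eq_integral) (auto simp: N0)
    show "D \<le> (\<integral>p. N p \<partial>\<pi>)"
      unfolding D[symmetric] using i fh le' by (intro integral_mono_AE) auto
  qed
  show "ennreal ((\<integral>x. f x \<partial>\<mu>) + (\<integral>y. h y \<partial>\<nu>)) \<le> kantorovich_cost \<pi>"
    unfolding D_def[symmetric]
  proof (cases "kantorovich_cost \<pi> < \<infinity>")
    case True
    show "ennreal D \<le> kantorovich_cost \<pi>"
      unfolding fin(1)[OF True] using fin(3)[OF True] by (rule ennreal_leI)
  qed (simp add: less_top[symmetric])
  show "0 \<le> (\<integral>x. f x \<partial>\<mu>) + (\<integral>y. h y \<partial>\<nu>) \<and>
      kantorovich_cost \<pi> = ennreal ((\<integral>x. f x \<partial>\<mu>) + (\<integral>y. h y \<partial>\<nu>)) \<longleftrightarrow>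
      (AE p in \<pi>. f (fst p) + h (snd p) = norm (fst p - snd p))"
    unfolding D_def[symmetric] N_def[symmetric]
  proof
    assume eq: "0 \<le> D \<and> kantorovich_cost \<pi> = ennreal D"
    then have lt: "kantorovich_cost \<pi> < \<infinity>" by simp
    have "0 \<le> (\<integral>p. N p \<partial>\<pi>)" by (simp add: N_def)
    then have ND: "(\<integral>p. N p \<partial>\<pi>) = D"
      using eq fin(1)[OF lt] by (metis ennreal_inj)
    \<comment> \<open>The slack is nonnegative almost everywhere and has integral zero, so it
      vanishes almost everywhere.\<close>
    have "(\<integral>p. N p - (f (fst p) + h (snd p)) \<partial>\<pi>) = 0"
      using fin(2)[OF lt] fh D ND by simp
    moreover have "integrable \<pi> (\<lambda>p. N p - (f (fst p) + h (snd p)))"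
      using fin(2)[OF lt] fh by simp
    ultimately have "AE p in \<pi>. N p - (f (fst p) + h (snd p)) = 0"
      using le' by (subst (asm) integral_nonneg_eq_0_iff_AE) auto
    then show "AE p in \<pi>. f (fst p) + h (snd p) = N p" by eventually_elim simp
  next
    assume ae: "AE p in \<pi>. f (fst p) + h (snd p) = N p"
    \<comment> \<open>Finiteness of the cost is a consequence here, as \<open>N\<close> agrees
      almost everywhere with an integrable function.\<close>
    have "kantorovich_cost \<pi> = (\<integral>\<^sup>+p. ennreal (f (fst p) + h (snd p)) \<partial>\<pi>)"
      unfolding K using ae by (intro nn_integral_cong_AE) (auto elim!: eventually_mono)
    also have "\<dots> = ennreal D"
      unfolding D[symmetric] using fh ae
      by (intro nn_integral_eq_integral) (auto elim!: eventually_mono simp: N_def)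
    finally have "kantorovich_cost \<pi> = ennreal D" .
    moreover have "0 \<le> D"
      unfolding D[symmetric] using ae by (intro integral_nonneg_AE) (auto elim!: eventually_mono simp: N_def)
    ultimately show "0 \<le> D \<and> kantorovich_cost \<pi> = ennreal D" by simp
  qed
qed


section \<open>The semi-discrete transport problem\<close>

theorem theorem1:
  fixes X Y :: "(real ^ 'd) set"
    and \<mu> \<nu> :: "(real ^ 'd) measure"
    and n :: nat
    and y :: "nat \<Rightarrow> real ^ 'd"
    and w :: "nat \<Rightarrow> real"
  assumes "CARD('d) \<ge> 2"
    and "X \<in> sets borel" and "Y \<in> sets borel"
    and "prob_space \<mu>"
    and "sets \<mu> = sets (restrict_space borel X)"
    and "absolutely_continuous (restrict_space lborel X) \<mu>"
    and "(\<integral>\<^sup>+ x. ennreal (norm x) \<partial>\<mu>) < \<infinity>"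
    and "prob_space \<nu>"
    and "sets \<nu> = sets (restrict_space borel Y)"
    and "\<And>j. j \<in> {1..n} \<Longrightarrow> y j \<in> Y"
    and "inj_on y {1..n}"
    and "\<And>j. j \<in> {1..n} \<Longrightarrow> w j \<in> {0<..1}"
    and "\<And>A. A \<in> sets \<nu> \<Longrightarrow>
           emeasure \<nu> A =
             (\<Sum>j = 1..n. ennreal (w j) * emeasure (return (restrict_space borel Y) (y j)) A)"
  shows "\<exists>T. monge_solution \<mu> \<nu> T \<and>
           (\<forall>S S'. monge_solution \<mu> \<nu> S \<longrightarrow> monge_solution \<mu> \<nu> S' \<longrightarrow>
              (AE x in \<mu>. S x = S' x)) \<and>
           kantorovich_solution \<mu> \<nu> (induced_coupling \<mu> \<nu> T) \<and>
           (\<forall>\<pi>. kantorovich_solution \<mu> \<nu> \<pi> \<longrightarrow> \<pi> = induced_coupling \<mu> \<nu> T) \<and>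
           W1 \<mu> \<nu> = (\<integral>\<^sup>+ x. ennreal (norm (x - T x)) \<partial>\<mu>)"
proof -
  interpret \<mu>: prob_space \<mu> by fact
  interpret \<nu>: prob_space \<nu> by fact
  define J where "J = {1..n}"
  have space: "space \<mu> = X" "space \<nu> = Y"
    using sets_eq_imp_space_eq[OF assms(5)] sets_eq_imp_space_eq[OF assms(9)]
    by (simp_all add: space_restrict_space)
  have id_\<mu> [measurable]: "(\<lambda>x. x) \<in> borel_measurable \<mu>"
    and id_\<nu> [measurable]: "(\<lambda>x. x) \<in> borel_measurable \<nu>"
    unfolding measurable_cong_sets[OF assms(5) refl] measurable_cong_sets[OF assms(9) refl]
    by (auto intro: measurable_restrict_space1)
  have [measurable]: "fst \<in> borel_measurable (\<mu> \<Otimes>\<^sub>M \<nu>)" "snd \<in> borel_measurable (\<mu> \<Otimes>\<^sub>M \<nu>)"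
    using measurable_compose[OF measurable_fst id_\<mu>] measurable_compose[OF measurable_snd id_\<nu>]
    by auto
  have norm_meas: "(\<lambda>(x, y). norm (x - y)) \<in> borel_measurable (\<mu> \<Otimes>\<^sub>M \<nu>)"
    unfolding split_beta' by measurable
  have sing: "{y j} \<in> sets \<nu>" if "j \<in> J" for j
    using that assms(3,10) by (auto simp: assms(9) sets_restrict_space_iff J_def)
  have \<nu>: "emeasure \<nu> A = (\<Sum>j\<in>J. ennreal (w j) * indicator A (y j))" if "A \<in> sets \<nu>" for A
    using assms(13)[OF that] that by (simp add: J_def assms(9))
  have y_eq: "y j = y k \<longleftrightarrow> j = k" if "j \<in> J" "k \<in> J" for j k
    using that inj_on_eq_iff[OF assms(11)] by (simp add: J_def)
  have w0: "0 \<le> w j" if "j \<in> J" for j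
    using assms(12)[of j] that by (auto simp: J_def)
  \<comment> \<open>That the weights sum to one, and hence that \<open>J\<close> is nonempty, comes
    from the total mass of \<nu>.\<close>
  have "ennreal (sum w J) = (\<Sum>j\<in>J. ennreal (w j))"
    using w0 by (rule sum_ennreal[symmetric])
  also have "\<dots> = (\<Sum>j\<in>J. ennreal (w j) * indicator Y (y j))"
    using assms(10) by (intro sum.cong) (auto simp: J_def)
  also have "\<dots> = 1"
    using \<nu>[OF sets.top] \<nu>.emeasure_space_1 by (simp add: space)
  finally have w1: "sum w J = 1" by simp
  have "finite J" by (simp add: J_def)
  moreover have "J \<noteq> {}" using w1 by auto
  ultimately have J: "finite J" "J \<noteq> {}" by auto

  define c where "c j x = norm (x - y j)" for j and x :: "real ^ 'd"
  \<comment> \<open>The distances may be unbounded in \<open>x\<close>, but their differences are at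
    most \<open>norm (y j) + norm (y k)\<close>. The factor 2 allows for both terms, also when
    \<open>j = k\<close>.\<close>
  define R where "R = 2 * (\<Sum>j\<in>J. norm (y j))"
  have norm_int: "integrable \<mu> norm"
    using assms(7) by (intro integrableI_bounded) auto
  have c_int: "integrable \<mu> (c j)" for j
  proof (rule Bochner_Integration.integrable_bound)
    show "integrable \<mu> (\<lambda>x. norm x + norm (y j))" using norm_int by simp
    show "c j \<in> borel_measurable \<mu>" unfolding c_def by measurable
    show "AE x in \<mu>. norm (c j x) \<le> norm (norm x + norm (y j))"
      by (intro always_eventually) (simp add: c_def norm_triangle_ineq4)
  qed
  have c_diff: "c j x - c k x \<le> R" if "j \<in> J" "k \<in> J" for j k x
  proof -
    have le: "c j x - c k x \<le> norm (y j) + norm (y k)"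
      unfolding c_def by norm
    have "norm (y i) \<le> (\<Sum>j\<in>J. norm (y j))" if "i \<in> J" for i
      using that J(1) by (intro member_le_sum) auto
    from this[OF that(1)] this[OF that(2)] show ?thesis using le by (simp add: R_def)
  qed
  have ties: "AE x in \<mu>. c j x - c k x \<noteq> t" if "j \<in> J" "k \<in> J" "j \<noteq> k" for j k t
  proof -
    let ?S = "{x. norm (x - y j) - norm (x - y k) = t}"
    have "y j \<noteq> y k" using that y_eq by blast
    then have "?S \<in> null_sets lebesgue"
      unfolding negligible_iff_null_sets[symmetric]
      using assms(1) by (intro negligible_dist_difference) auto
    \<comment> \<open>The set is Borel, so being Lebesgue null passes to \<open>lborel\<close>;
      intersecting with \<open>X\<close> then matches the restricted measure in the absolute
      continuity hypothesis.\<close>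
    moreover have S: "?S \<in> sets borel"
      by (intro borel_closed closed_Collect_eq continuous_intros)
    ultimately have "?S \<in> null_sets lborel"
      by (simp add: null_sets_completion_iff)
    then have "X \<inter> ?S \<in> null_sets (restrict_space lborel X)"
      using assms(2) by (subst null_sets_restrict_space) (auto intro: null_set_Int1)
    then have "X \<inter> ?S \<in> null_sets \<mu>"
      using assms(6) by (auto simp: absolutely_continuous_def)
    then show ?thesis
      by (intro AE_I'[of "X \<inter> ?S"]) (auto simp: c_def space)
  qed
  obtain \<phi> where \<phi>: "\<And>j. j \<in> J \<Longrightarrow>
      measure \<mu> {x \<in> space \<mu>. c j x - \<phi> j = c_transform J c \<phi> x} = w j"
    by (rule optimal_cell_weights[OF assms(4) J, of c R w]) (use c_int c_diff ties w0 w1 in auto)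
  define f where "f = c_transform J c \<phi>"
  \<comment> \<open>The potential, extended by 0 off the atoms.\<close>
  define h where "h v = (\<Sum>j\<in>J. \<phi> j * indicator {y j} v)" for v
  have f_int: "integrable \<mu> f"
    unfolding f_def using J \<mu>.finite_measure_axioms c_int by (rule integrable_c_transform)
  have h_int: "integrable \<nu> h"
    unfolding h_def using sing
    by (intro Bochner_Integration.integrable_sum integrable_mult_right integrable_real_indicator)
      (auto simp: less_top[symmetric])
  have h_y: "h (y j) = \<phi> j" if "j \<in> J" for j
  proof -
    have "h (y j) = (\<Sum>i\<in>J. if i = j then \<phi> i else 0)"
      unfolding h_def using that y_eq
      by (intro sum.cong) (auto simp: indicator_def)
    then show ?thesis using that J(1) by simp
  qed
  have f_le: "f x \<le> c j x - \<phi> j" if "j \<in> J" for j x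
    unfolding f_def using J(1) that by (rule c_transform_le)

  \<comment> \<open>Taking the least minimizing index gives a measurable choice; any other choice
    agrees with it almost everywhere because ties are null.\<close>
  define idx where "idx x = (LEAST j. j \<in> J \<and> c j x - \<phi> j = f x)" for x
  define T where "T x = y (idx x)" for x
  have idx: "idx x \<in> J" "c (idx x) x - \<phi> (idx x) = f x" for x
  proof -
    obtain j where "j \<in> J \<and> c j x - \<phi> j = f x"
      using c_transform_attained[OF J, of c \<phi> x] unfolding f_def by metis
    then have "idx x \<in> J \<and> c (idx x) x - \<phi> (idx x) = f x"
      unfolding idx_def by (rule LeastI)
    then show "idx x \<in> J" "c (idx x) x - \<phi> (idx x) = f x" by auto
  qed
  have f_T: "f x + h (T x) = norm (x - T x)" for x
    using idx[of x] by (simp add: T_def h_y c_def)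
  have [measurable]: "f \<in> borel_measurable \<mu>" "h \<in> borel_measurable \<nu>"
    "c j \<in> borel_measurable \<mu>" for j
    using f_int h_int c_int by auto
  have "idx \<in> measurable \<mu> (count_space UNIV)"
    unfolding idx_def by measurable
  then have T_borel [measurable]: "T \<in> borel_measurable \<mu>"
    unfolding T_def by (rule measurable_compose) simp
  have T_Y: "T x \<in> Y" for x
    using idx(1)[of x] assms(10) by (simp add: T_def J_def)
  have T_meas: "T \<in> measurable \<mu> \<nu>"
    unfolding measurable_cong_sets[OF refl assms(9)]
    using T_Y by (intro measurable_restrict_space2) auto
  \<comment> \<open>Off the ties at the finitely many thresholds \<open>\<phi> j - \<phi> k\<close>,
    exactly one index is minimal.\<close>
  have "AE x in \<mu>. \<forall>j\<in>J. \<forall>k\<in>J. j \<noteq> k \<longrightarrow> c j x - c k x \<noteq> \<phi> j - \<phi> k"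
    using J(1) ties by (auto intro!: AE_finite_allI simp del: diff_eq_eq)
  then have T_unique: "AE x in \<mu>. \<forall>j\<in>J. c j x - \<phi> j = f x \<longleftrightarrow> T x = y j"
  proof eventually_elim
    case (elim x)
    have "idx x = j" if "j \<in> J" "c j x - \<phi> j = f x" for j
    proof (rule ccontr)
      assume "idx x \<noteq> j"
      then have "c (idx x) x - c j x \<noteq> \<phi> (idx x) - \<phi> j"
        using elim idx(1) that(1) by blast
      then show False using idx(2)[of x] that(2) by linarith
    qed
    moreover have "idx x = j" if "j \<in> J" "T x = y j" for j
      using that idx(1)[of x] y_eq by (auto simp: T_def)
    ultimately show ?case using idx(2)[of x] by (metis T_def)
  qed

  have T_map: "transport_map \<mu> \<nu> T"
    unfolding transport_map_iff
  proof (intro conjI ballI T_meas)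
    fix A assume A: "A \<in> sets \<nu>"
    define P where "P j = {x \<in> space \<mu>. T x = y j}" for j
    have Pm: "P j \<in> sets \<mu>" for j unfolding P_def by measurable
    have P: "emeasure \<mu> (P j) = ennreal (w j)" if "j \<in> J" for j
    proof -
      \<comment> \<open>\<open>P j\<close> and the \<open>j\<close>-th cell differ by a null set, so
        the cell mass from dual optimality is the mass sent to \<open>y j\<close>.\<close>
      have "emeasure \<mu> (P j) = emeasure \<mu> {x \<in> space \<mu>. c j x - \<phi> j = f x}"
        using T_unique Pm that
        by (intro emeasure_eq_AE) (auto elim!: eventually_mono simp: P_def)
      then show ?thesis
        using \<phi>[OF that] by (simp add: \<mu>.emeasure_eq_measure f_def)
    qed
    have "T -` A \<inter> space \<mu> = (\<Union>j\<in>{j \<in> J. y j \<in> A}. P j)"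
      using idx(1) by (fastforce simp: P_def T_def)
    also have "emeasure \<mu> \<dots> = (\<Sum>j\<in>{j \<in> J. y j \<in> A}. emeasure \<mu> (P j))"
      using J(1) Pm y_eq
      by (intro sum_emeasure[symmetric]) (auto simp: disjoint_family_on_def P_def)
    also have "\<dots> = (\<Sum>j\<in>{j \<in> J. y j \<in> A}. ennreal (w j))"
      using P by (intro sum.cong) auto
    also have "\<dots> = (\<Sum>j\<in>J. ennreal (w j) * indicator A (y j))"
      using J(1) by (intro sum.mono_neutral_cong_left) auto
    finally show "emeasure \<mu> (T -` A \<inter> space \<mu>) = emeasure \<nu> A"
      using \<nu>[OF A] by simp
  qed
  let ?\<pi> = "induced_coupling \<mu> \<nu> T"
  have T_plan: "transport_plan \<mu> \<nu> ?\<pi>"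
    using T_map by (rule transport_plan_induced_coupling)

  have "y ` J \<in> sets \<nu>"
    using J(1) sing sets.finite_UN[of J "\<lambda>j. {y j}" \<nu>] by (simp add: UNION_singleton_eq_range)
  then have N: "space \<nu> - y ` J \<in> sets \<nu>" by auto
  moreover have "emeasure \<nu> (space \<nu> - y ` J) = 0"
    unfolding \<nu>[OF N] by (intro sum.neutral) auto
  ultimately have supp: "AE v in \<nu>. v \<in> y ` J"
    by (intro AE_I'[of "space \<nu> - y ` J"]) auto

  \<comment> \<open>The dual value, which turns out to be the optimum of both problems.\<close>
  define D where "D = (\<integral>x. f x \<partial>\<mu>) + (\<integral>v. h v \<partial>\<nu>)"
  have plan_supp: "AE p in \<pi>. snd p \<in> y ` J"
    and plan_unique: "AE p in \<pi>. \<forall>j\<in>J. c j (fst p) - \<phi> j = f (fst p) \<longleftrightarrow> T (fst p) = y j"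
    if \<pi>: "transport_plan \<mu> \<nu> \<pi>" for \<pi>
  proof -
    have sets [measurable_cong]: "sets \<pi> = sets (\<mu> \<Otimes>\<^sub>M \<nu>)"
      using \<pi> by (simp add: transport_plan_def)
    have "fst \<in> measurable \<pi> \<mu>" "snd \<in> measurable \<pi> \<nu>" by measurable
    then show "AE p in \<pi>. snd p \<in> y ` J"
      "AE p in \<pi>. \<forall>j\<in>J. c j (fst p) - \<phi> j = f (fst p) \<longleftrightarrow> T (fst p) = y j"
      using supp T_unique AE_distrD[of fst \<pi> \<mu>] AE_distrD[of snd \<pi> \<nu>]
      unfolding distr_transport_plan[OF \<pi>] by auto
  qed
  \<comment> \<open>The inequality need not hold off the atoms, where \<open>h\<close> is 0; but
    every plan is concentrated on pairs whose second entry is an atom.\<close>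
  have plan_le: "AE p in \<pi>. f (fst p) + h (snd p) \<le> norm (fst p - snd p)"
    if \<pi>: "transport_plan \<mu> \<nu> \<pi>" for \<pi>
    using plan_supp[OF \<pi>]
  proof eventually_elim
    case (elim p)
    then obtain j where "j \<in> J" "snd p = y j" by auto
    then show ?case using f_le[of j "fst p"] by (simp add: h_y c_def)
  qed
  note duality = kantorovich_cost_duality[OF _ norm_meas f_int h_int plan_le, folded D_def]
  have lower: "ennreal D \<le> kantorovich_cost \<pi>" if "transport_plan \<mu> \<nu> \<pi>" for \<pi>
    using that by (intro duality)
  have "AE p in ?\<pi>. f (fst p) + h (snd p) = norm (fst p - snd p)"
    unfolding induced_coupling_def using T_meas f_T by (subst AE_distr_iff) auto
  then have D: "0 \<le> D" "kantorovich_cost ?\<pi> = ennreal D"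
    using duality(2)[OF T_plan T_plan] by auto
  \<comment> \<open>Equality in the duality puts the first coordinate in the cell of the second, and
    almost every point lies in no cell but that of its image under \<open>T\<close>.\<close>
  have tight: "AE p in \<pi>. snd p = T (fst p)"
    if \<pi>: "transport_plan \<mu> \<nu> \<pi>" and cost: "kantorovich_cost \<pi> = ennreal D" for \<pi>
  proof -
    have "AE p in \<pi>. f (fst p) + h (snd p) = norm (fst p - snd p)"
      using duality(2)[OF \<pi> \<pi>] D(1) cost by auto
    then show ?thesis
      using plan_supp[OF \<pi>] plan_unique[OF \<pi>]
    proof eventually_elim
      case (elim p)
      then obtain j where j: "j \<in> J" "snd p = y j" by auto
      then have "c j (fst p) - \<phi> j = f (fst p)"
        using elim(1) by (simp add: h_y c_def)
      then show ?case using elim(3) j by auto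
    qed
  qed
  have W1: "W1 \<mu> \<nu> = ennreal D"
    unfolding W1_def using lower T_plan D(2)
    by (intro antisym INF_greatest) (auto intro: INF_lower2)
  have map_cost: "kantorovich_cost (induced_coupling \<mu> \<nu> S) = monge_cost \<mu> S"
    if "transport_map \<mu> \<nu> S" for S
    using that norm_meas by (intro kantorovich_cost_induced_coupling) (auto simp: transport_map_iff)
  have T_cost: "monge_cost \<mu> T = ennreal D"
    using map_cost[OF T_map] D(2) by simp
  have INF: "(INF S \<in> {S. transport_map \<mu> \<nu> S}. monge_cost \<mu> S) = ennreal D"
  proof (rule antisym)
    show "(INF S \<in> {S. transport_map \<mu> \<nu> S}. monge_cost \<mu> S) \<le> ennreal D"
      using T_map T_cost by (intro INF_lower2[of T]) auto
    \<comment> \<open>Every transport map induces a plan of equal cost, so the bound for plans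
      applies to maps.\<close>
    show "ennreal D \<le> (INF S \<in> {S. transport_map \<mu> \<nu> S}. monge_cost \<mu> S)"
      using lower transport_plan_induced_coupling map_cost by (intro INF_greatest) fastforce
  qed
  have monge_unique: "AE x in \<mu>. S x = T x" if S: "monge_solution \<mu> \<nu> S" for S
  proof -
    have map: "transport_map \<mu> \<nu> S" and "monge_cost \<mu> S = ennreal D"
      using S INF by (auto simp: monge_solution_def)
    \<comment> \<open>The coupling induced by an optimal \<open>S\<close> is an optimal plan, hence
      concentrated on the graph of \<open>T\<close>; pulling this back to \<mu> compares
      \<open>S\<close> with \<open>T\<close>.\<close>
    then have "AE p in induced_coupling \<mu> \<nu> S. snd p = T (fst p)"
      using tight[OF transport_plan_induced_coupling[OF map]] map_cost by simp
    moreover have "(\<lambda>x. (x, S x)) \<in> measurable \<mu> (\<mu> \<Otimes>\<^sub>M \<nu>)"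
      using map by (auto simp: transport_map_iff)
    ultimately have "AE x in \<mu>. snd (x, S x) = T (fst (x, S x))"
      unfolding induced_coupling_def by (rule AE_distrD[rotated])
    then show ?thesis by simp
  qed
  show ?thesis
  proof (intro exI[of _ T] conjI allI impI)
    show "monge_solution \<mu> \<nu> T"
      using T_map T_cost INF by (simp add: monge_solution_def)
    show "AE x in \<mu>. S x = S' x" if "monge_solution \<mu> \<nu> S" "monge_solution \<mu> \<nu> S'" for S S'
      using monge_unique[OF that(1)] monge_unique[OF that(2)] by eventually_elim simp
    show "kantorovich_solution \<mu> \<nu> ?\<pi>"
      using T_plan D(2) W1 by (simp add: kantorovich_solution_def)
    show "\<pi> = ?\<pi>" if "kantorovich_solution \<mu> \<nu> \<pi>" for \<pi>
      using that W1 T_meas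
      by (intro transport_plan_eq_induced_coupling tight) (auto simp: kantorovich_solution_def)
    show "W1 \<mu> \<nu> = (\<integral>\<^sup>+ x. ennreal (norm (x - T x)) \<partial>\<mu>)"
      using W1 T_cost by (simp add: monge_cost_def)
  qed
qed

end
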